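(* Let $\mathbf{R}_u,\mathbf{R}_0\in\mathbb{R}^3$ and $\mathbf{R}(u)=\mathbf{R}_u u+\mathbf{R}_0$. Define $$r_n^m(u)=R_n^m(\mathbf{R}(u)),\qquad p_n^m=\int_0^1 r_n^m(u)\,du,\qquad q_n^m=r_n^m(1).$$ Then for all integers $n\ge 1$ and $-n\le m\le n$, $$p_n^m=\frac{1}{n+1}\left[i\xi_0\,p_{n-1}^{m-1}+i\eta_0\,p_{n-1}^{m+1}-z_0\,p_{n-1}^m+q_n^m\right],$$ where, writing $\mathbf{R}_0=(x_0,y_0,z_0)$, $\xi_0=\frac{x_0+iy_0}{2}$ and $\eta_0=\frac{x_0-iy_0}{2}$.
   Context: Harmonic polynomials: for $\mathbf{r}=(x,y,z)=r(\sin\theta\cos\varphi,\sin\theta\sin\varphi,\cos\theta)\in\mathbb{R}^3$, integers $n\ge 0$ and $-n\le m\le n$, $$R_n^m(\mathbf{r})=\frac{(-1)^n i^{|m|}}{(n+|m|)!}\,r^n P_n^{|m|}(\cos\theta)\,e^{im\varphi},$$ and $R_n^m\equiv 0$ for $|m|>n$. Each $R_n^m$ is a homogeneous polynomial of degree $n$ in $(x,y,z)$ (this defines it also at points where $\theta,\varphi$ are not uniquely defined; $R_0^0\equiv 1$). The associated Legendre functions are, for integers $n,m\ge 0$, $$P_n^m(\mu)=\frac{(-1)^m(1-\mu^2)^{m/2}}{2^n n!}\frac{d^{m+n}}{d\mu^{m+n}}(\mu^2-1)^n.$$ Accordingly all indexed quantities built from $R_n^m$ vanish when $|m|>n$. Here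 $i$ (not as an indexed quantity) is the imaginary unit. *)

theory Defs
  imports "HOL-Analysis.Analysis"
begin

(* The half-integer power is written as a power of the square root because
   0 powr 0 = 0, which would give the wrong value at mu = 1, -1 for m = 0. *)
definition assoc_legendre :: "nat \<Rightarrow> nat \<Rightarrow> real \<Rightarrow> real" where
  "assoc_legendre n m \<mu> =
     (-1) ^ m * sqrt (1 - \<mu>\<^sup>2) ^ m / (2 ^ n * fact n)
       * (deriv ^^ (m + n)) (\<lambda>t. (t\<^sup>2 - 1) ^ n) \<mu>"

(* Polar and azimuthal angle of a point.  On the z-axis the azimuth, and at the
   origin both angles, are arbitrary; the junk values chosen by Arg 0 = 0 and
   z / 0 = 0 do not matter, see harmonic_R_spherical. *)
definition polar_angle :: "real^3 \<Rightarrow> real" where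
  "polar_angle v = arccos (v $ 3 / norm v)"

definition azimuth :: "real^3 \<Rightarrow> real" where
  "azimuth v = Arg (Complex (v $ 1) (v $ 2))"

definition harmonic_R :: "nat \<Rightarrow> int \<Rightarrow> real^3 \<Rightarrow> complex" where
  "harmonic_R n m v =
     (if \<bar>m\<bar> > int n then 0
      else (-1) ^ n * \<i> ^ nat \<bar>m\<bar> / fact (n + nat \<bar>m\<bar>)
             * of_real (norm v ^ n * assoc_legendre n (nat \<bar>m\<bar>) (cos (polar_angle v)))
             * exp (\<i> * of_int m * of_real (azimuth v)))"

definition segment_point :: "real^3 \<Rightarrow> real^3 \<Rightarrow> real \<Rightarrow> real^3" where
  "segment_point Ru R0 u = u *\<^sub>R Ru + R0"

definition seg_r :: "real^3 \<Rightarrow> real^3 \<Rightarrow> nat \<Rightarrow> int \<Rightarrow> real \<Rightarrow> complex" where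
  "seg_r Ru R0 n m u = harmonic_R n m (segment_point Ru R0 u)"

definition seg_p :: "real^3 \<Rightarrow> real^3 \<Rightarrow> nat \<Rightarrow> int \<Rightarrow> complex" where
  "seg_p Ru R0 n m = integral {0..1} (seg_r Ru R0 n m)"

definition seg_q :: "real^3 \<Rightarrow> real^3 \<Rightarrow> nat \<Rightarrow> int \<Rightarrow> complex" where
  "seg_q Ru R0 n m = seg_r Ru R0 n m 1"

definition \<xi>\<^sub>0 :: "real^3 \<Rightarrow> complex" where
  "\<xi>\<^sub>0 v = (of_real (v $ 1) + \<i> * of_real (v $ 2)) / 2"

definition \<eta>\<^sub>0 :: "real^3 \<Rightarrow> complex" where
  "\<eta>\<^sub>0 v = (of_real (v $ 1) - \<i> * of_real (v $ 2)) / 2"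


lemma assoc_legendre_0_0: "assoc_legendre 0 0 \<mu> = 1"
  by (simp add: assoc_legendre_def)

lemma norm_spherical:
  fixes r \<theta> \<phi> :: real
  assumes "r \<ge> 0"
  shows "norm (vector [r * sin \<theta> * cos \<phi>, r * sin \<theta> * sin \<phi>, r * cos \<theta>] :: real^3) = r"
proof -
  have "(r * sin \<theta> * cos \<phi>)\<^sup>2 + (r * sin \<theta> * sin \<phi>)\<^sup>2 + (r * cos \<theta>)\<^sup>2
      = r\<^sup>2 * ((sin \<theta>)\<^sup>2 * ((sin \<phi>)\<^sup>2 + (cos \<phi>)\<^sup>2) + (cos \<theta>)\<^sup>2)"
    by (simp only: power_mult_distrib) (simp only: algebra_simps)
  also have "\<dots> = r\<^sup>2" by simp
  finally show ?thesis
    using assms by (simp add: norm_vec_def L2_set_def sum_3 vector_3)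
qed

(* The spherical-coordinate formula holds for every choice of coordinates of a
   point, including at the points where they are not unique. *)
lemma harmonic_R_spherical:
  fixes r \<theta> \<phi> :: real and n :: nat and m :: int
  assumes "r \<ge> 0" "0 \<le> \<theta>" "\<theta> \<le> pi" "\<bar>m\<bar> \<le> int n"
  shows "harmonic_R n m (vector [r * sin \<theta> * cos \<phi>, r * sin \<theta> * sin \<phi>, r * cos \<theta>])
       = (-1) ^ n * \<i> ^ nat \<bar>m\<bar> / fact (n + nat \<bar>m\<bar>)
           * of_real (r ^ n * assoc_legendre n (nat \<bar>m\<bar>) (cos \<theta>))
           * exp (\<i> * of_int m * of_real \<phi>)"
proof -
  define v :: "real^3" where
    "v = vector [r * sin \<theta> * cos \<phi>, r * sin \<theta> * sin \<phi>, r * cos \<theta>]"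
  have nv: "norm v = r" unfolding v_def by (rule norm_spherical) fact
  have v: "v $ 1 = r * sin \<theta> * cos \<phi>" "v $ 2 = r * sin \<theta> * sin \<phi>" "v $ 3 = r * cos \<theta>"
    by (simp_all add: v_def)
  consider "r = 0" | "r > 0" "sin \<theta> = 0" | "r > 0" "sin \<theta> > 0"
    using assms sin_ge_zero[of \<theta>] by fastforce
  then show ?thesis
  proof cases
    case 1
    then show ?thesis unfolding v_def[symmetric]
      using assms nv by (cases n) (simp_all add: harmonic_R_def assoc_legendre_0_0)
  next
    case 2
    have th: "polar_angle v = \<theta>"
      using assms 2 by (simp add: polar_angle_def nv v arccos_cos)
    have "assoc_legendre n (nat \<bar>m\<bar>) (cos \<theta>) = 0" if "m \<noteq> 0"
    proof -
      have "1 - (cos \<theta>)\<^sup>2 = 0" using 2 by (simp add: cos_squared_eq)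
      with that show ?thesis by (simp add: assoc_legendre_def)
    qed
    then show ?thesis unfolding v_def[symmetric]
      using assms by (cases "m = 0") (simp_all add: harmonic_R_def th nv)
  next
    case 3
    have th: "polar_angle v = \<theta>"
      using assms 3 by (simp add: polar_angle_def nv v arccos_cos)
    have c: "Complex (v $ 1) (v $ 2) = rcis (r * sin \<theta>) \<phi>"
      by (simp add: v complex_eq_iff)
    have "r * sin \<theta> \<noteq> 0" using 3 by simp
    then have "Complex (v $ 1) (v $ 2) \<noteq> 0" unfolding c by simp
    then have "cis (azimuth v) = sgn (Complex (v $ 1) (v $ 2))"
      by (simp add: azimuth_def cis_Arg)
    also have "\<dots> = cis \<phi>"
      using 3 unfolding c by (simp add: rcis_def sgn_div_norm norm_mult scaleR_conv_of_real field_simps)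
    finally have "cis (azimuth v) powi m = cis \<phi> powi m" by simp
    then have "exp (\<i> * of_int m * of_real (azimuth v)) = exp (\<i> * of_int m * of_real \<phi>)"
      by (simp only: cis_power_int) (simp add: cis_conv_exp mult_ac)
    then show ?thesis unfolding v_def[symmetric]
      using assms by (simp add: harmonic_R_def th nv)
  qed
qed

end

theory Submission
  imports Defs
begin

text \<open>With \<open>\<xi> = (x + \<i>y)/2\<close> and \<open>\<eta> = (x - \<i>y)/2\<close>, the polynomial \<open>R\<^sub>n\<^sup>m\<close> is the coefficient of
  \<open>t\<^sup>n\<^sup>+\<^sup>m\<close> in \<open>g\<^sup>n / n!\<close>, where \<open>g = \<i>\<eta> - z t + \<i>\<xi> t\<^sup>2\<close> depends linearly on the point.
  On the segment, \<open>g = u g\<^sub>u + g\<^sub>0\<close>. Splitting one factor off \<open>g\<^sup>n\<close> gives \<open>n r = u r' + T\<close>, where \<open>T\<close> is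
  the coefficient of \<open>g\<^sub>0 g\<^sup>n\<^sup>-\<^sup>1 / (n-1)!\<close>, i.e. the combination of the three \<open>r\<^sub>n\<^sub>-\<^sub>1\<close> terms in the claim.
  Hence \<open>(u r)' = (n + 1) r - T\<close>, to be integrated over \<open>[0, 1]\<close>.\<close>

section \<open>Coefficients of powers of a quadratic\<close>

lemma coeff_quadratic_mult:
  fixes a b c :: "'a::comm_ring_1"
  shows "coeff ([:a, b, c:] * p) k =
    a * coeff p k + (if 1 \<le> k then b * coeff p (k - 1) else 0)
      + (if 2 \<le> k then c * coeff p (k - 2) else 0)"
  by (auto simp: mult_pCons_left coeff_pCons split: nat.splits)

lemma coeff_quadratic_power_eq_0:
  fixes a b c :: "'a::comm_ring_1"
  assumes "2 * n < k"
  shows "coeff ([:a, b, c:] ^ n) k = 0"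
  using assms
proof (induction n arbitrary: k)
  case 0
  then show ?case by simp
next
  case (Suc n)
  then show ?case by (simp add: coeff_quadratic_mult del: mult_pCons_left)
qed

text \<open>Reversing the coefficients turns g(t) into t^2 g(1/t), hence its n-th power into t^(2n)
  g(1/t)^n. This reduces negative orders m to positive ones.\<close>

lemma coeff_quadratic_power_reflect:
  fixes a b c :: "'a::comm_ring_1"
  assumes "k + j = 2 * n"
  shows "coeff ([:a, b, c:] ^ n) k = coeff ([:c, b, a:] ^ n) j"
  using assms
proof (induction n arbitrary: k j)
  case 0
  then show ?case by simp
next
  case (Suc n)
  let ?P = "[:a, b, c:] ^ n" and ?Q = "[:c, b, a:] ^ n"
  \<comment> \<open>With one factor removed, the index pairs (k, j - 2), (k - 1, j - 1), (k - 2, j)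
    each sum to 2n. Where one index would be negative, its partner exceeds 2n and that coefficient
    vanishes.\<close>
  have 0: "coeff ?P k = (if 2 \<le> j then coeff ?Q (j - 2) else 0)"
    using Suc.prems by (auto intro!: Suc.IH coeff_quadratic_power_eq_0)
  have 1: "(if 1 \<le> k then b * coeff ?P (k - 1) else 0) = (if 1 \<le> j then b * coeff ?Q (j - 1) else 0)"
  proof (cases "1 \<le> k \<and> 1 \<le> j")
    case True
    then have "coeff ?P (k - 1) = coeff ?Q (j - 1)"
      using Suc.prems by (intro Suc.IH) auto
    then show ?thesis using True by simp
  next
    case False
    then show ?thesis
      using Suc.prems coeff_quadratic_power_eq_0[of n "k - 1" a b c]
        coeff_quadratic_power_eq_0[of n "j - 1" c b a]
      by auto
  qed
  have 2: "coeff ?Q j = (if 2 \<le> k then coeff ?P (k - 2) else 0)"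
    using Suc.prems by (auto intro!: Suc.IH[symmetric] coeff_quadratic_power_eq_0)
  show ?case
    using 0 1 2 by (simp add: coeff_quadratic_mult del: mult_pCons_left)
qed

text \<open>The quadratic on the left is k g(l t), so each of the n factors contributes k and the
  substitution contributes \<open>l ^ j\<close>.\<close>

lemma coeff_quadratic_power_scale:
  fixes a b c k l :: "'a::comm_ring_1"
  shows "coeff ([:k * a, k * b * l, k * c * l\<^sup>2:] ^ n) j = k ^ n * l ^ j * coeff ([:a, b, c:] ^ n) j"
proof (induction n arbitrary: j)
  case 0
  then show ?case by (cases j) auto
next
  case (Suc n)
  consider "j = 0" | "j = 1" | i where "j = i + 2"
    by (metis One_nat_def add_2_eq_Suc' not0_implies_Suc)
  then show ?case
    by cases (simp_all only: power_Suc coeff_quadratic_mult Suc, simp_all add: algebra_simps power2_eq_square)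
qed

lemma coeff_quadratic_power_of_real:
  "coeff ([:of_real a, of_real b, of_real c:] ^ n :: complex poly) j = of_real (coeff ([:a, b, c:] ^ n) j)"
proof (induction n arbitrary: j)
  case 0
  then show ?case by (cases j) auto
next
  case (Suc n)
  then show ?case by (simp add: coeff_quadratic_mult del: mult_pCons_left)
qed

section \<open>Rodrigues' formula in terms of Taylor coefficients\<close>

lemma higher_deriv_poly:
  fixes p :: "real poly"
  shows "(deriv ^^ k) (poly p) = poly ((pderiv ^^ k) p)"
proof (induction k)
  case (Suc k)
  then show ?case by (auto intro!: ext DERIV_imp_deriv)
qed simp

text \<open>Taylor's formula at \<open>a\<close>: differentiation commutes with translation, which
  moves the evaluation point to 0.\<close>

lemma coeff_taylor_shift:
  fixes p :: "'a::field_char_0 poly"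
  shows "fact k * coeff (pcompose p [:a, 1:]) k = poly ((pderiv ^^ k) p) a"
proof -
  have *: "(pderiv ^^ k) (pcompose p [:a, 1:]) = pcompose ((pderiv ^^ k) p) [:a, 1:]"
    by (induction k) (simp_all add: pderiv_pcompose pderiv_pCons)
  have "poly ((pderiv ^^ k) p) a = poly (pcompose ((pderiv ^^ k) p) [:a, 1:]) 0"
    by (simp add: poly_pcompose)
  also have "\<dots> = coeff ((pderiv ^^ k) (pcompose p [:a, 1:])) 0"
    by (simp only: * poly_0_coeff_0)
  finally show ?thesis
    by (simp add: coeff_higher_pderiv pochhammer_fact)
qed

lemma legendre_deriv_eq_coeff:
  fixes \<mu> :: real
  shows "(deriv ^^ k) (\<lambda>t. (t\<^sup>2 - 1) ^ n) \<mu> = fact k * coeff ([:\<mu>\<^sup>2 - 1, 2 * \<mu>, 1:] ^ n) k"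
proof -
  have "(\<lambda>t::real. (t\<^sup>2 - 1) ^ n) = poly ([:-1, 0, 1:] ^ n)"
    by (simp add: fun_eq_iff power2_eq_square)
  moreover have "pcompose ([:-1, 0, 1:] ^ n) [:\<mu>, 1:] = [:\<mu>\<^sup>2 - 1, 2 * \<mu>, 1:] ^ n"
  proof -
    have "pcompose [:-1, 0, 1:] [:\<mu>, 1:] = [:\<mu>\<^sup>2 - 1, 2 * \<mu>, 1:]"
      by (simp add: pcompose_pCons power2_eq_square)
    then show ?thesis by (induction n) (simp_all add: pcompose_1 pcompose_mult del: mult_pCons_left)
  qed
  ultimately show ?thesis
    by (simp add: higher_deriv_poly coeff_taylor_shift[symmetric])
qed

text \<open>The quadratic on the left is a multiple of \<open>(\<mu> + \<tau> t)\<^sup>2 - 1\<close> for \<open>\<tau> = -\<i> s e\<close>, and the powers of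
  \<open>(\<mu> + t)\<^sup>2 - 1\<close> have the derivatives in Rodrigues' formula as Taylor coefficients.
  On the axis \<open>s = 0\<close> the substitution degenerates and both sides are computed directly.\<close>

lemma coeff_eq_assoc_legendre:
  fixes e e' :: complex and r \<mu> :: real
  assumes "\<bar>\<mu>\<bar> \<le> 1" "e * e' = 1"
  defines "s \<equiv> sqrt (1 - \<mu>\<^sup>2)"
  shows "coeff ([:\<i> * (r * s * e' / 2), - of_real (r * \<mu>), \<i> * (r * s * e / 2):] ^ n) (n + l) / fact n
    = (-1) ^ n * \<i> ^ l / fact (n + l) * of_real (r ^ n * assoc_legendre n l \<mu>) * e ^ l"
proof -
  let ?c = "coeff ([:\<mu>\<^sup>2 - 1, 2 * \<mu>, 1:] ^ n) (n + l)"
  have s2: "s\<^sup>2 = 1 - \<mu>\<^sup>2"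
    using assms(1) by (simp add: s_def abs_square_le_1)
  have leg: "assoc_legendre n l \<mu> = (-1) ^ l * s ^ l / (2 ^ n * fact n) * (fact (n + l) * ?c)"
    unfolding assoc_legendre_def legendre_deriv_eq_coeff s_def by (simp add: add.commute)
  have rhs: "(-1) ^ n * \<i> ^ l / fact (n + l) * of_real (r ^ n * assoc_legendre n l \<mu>) * e ^ l
    = (- of_real r / 2) ^ n * (- \<i> * s * e) ^ l * of_real ?c / fact n"
  proof -
    have "(- complex_of_real r / 2) ^ n = (-1) ^ n * of_real r ^ n / 2 ^ n"
      by (simp only: power_divide power_minus[of "complex_of_real r"])
    moreover have "(- \<i> * s * e) ^ l = (-1) ^ l * \<i> ^ l * s ^ l * e ^ l"
      by (simp only: power_mult_distrib power_minus[of "\<i>"] of_real_power)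
    ultimately show ?thesis unfolding leg by simp
  qed
  have "coeff ([:\<i> * (r * s * e' / 2), - of_real (r * \<mu>), \<i> * (r * s * e / 2):] ^ n) (n + l)
    = (- of_real r / 2) ^ n * (- \<i> * s * e) ^ l * of_real ?c"
  proof (cases "s = 0")
    case True
    have mu: "\<mu>\<^sup>2 - 1 = 0" using s2 True by simp
    have "[:0, 2 * \<mu>, 1:] ^ n = monom 1 n * [:2 * \<mu>, 1:] ^ n"
    proof -
      have "[:0, 2 * \<mu>, 1:] = monom 1 1 * [:2 * \<mu>, 1:]"
        by (simp add: monom_altdef)
      then show ?thesis by (simp only: power_mult_distrib monom_power) simp
    qed
    then have c: "?c = coeff ([:2 * \<mu>, 1:] ^ n) l"
      unfolding mu by (simp add: coeff_monom_mult)
    have "[:0, - of_real (r * \<mu>), 0:] = monom (- of_real (r * \<mu>) :: complex) 1"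
      by (simp add: monom_altdef)
    then have "coeff ([:0, - of_real (r * \<mu>), 0:] ^ n) (n + l)
      = (if l = 0 then (- of_real (r * \<mu>)) ^ n else 0 :: complex)"
      by (simp only: monom_power) simp
    moreover have "coeff ([:2 * \<mu>, 1:] ^ n) 0 = (2 * \<mu>) ^ n"
      by (simp flip: poly_0_coeff_0)
    moreover have "(- of_real (r * \<mu>)) ^ n = (- of_real r / 2) ^ n * complex_of_real ((2 * \<mu>) ^ n)"
      unfolding of_real_power power_mult_distrib[symmetric] by simp
    \<comment> \<open>For \<open>l > 0\<close> both sides vanish, the left being a coefficient of a
      monomial of degree n and the right carrying the factor \<open>s ^ l\<close>.\<close>
    ultimately show ?thesis
      unfolding c using True by (cases l) simp_all
  next
    case False
    then have e: "e \<noteq> 0" "complex_of_real s \<noteq> 0" using assms(2) by auto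
    define \<tau> where "\<tau> = - \<i> * s * e"
    \<comment> \<open>The middle coefficient forces this value: \<kappa> * 2 \<mu> * \<tau> must be
      - r \<mu>. The outer two then agree because of \<open>s2\<close> and
      \<open>e * e' = 1\<close>.\<close>
    define \<kappa> where "\<kappa> = - of_real r / 2 / \<tau>"
    have lam: "\<tau> \<noteq> 0" unfolding \<tau>_def using e by simp
    have kl: "\<kappa> * \<tau> = - of_real r / 2" unfolding \<kappa>_def using lam by simp
    have A: "\<kappa> * of_real (\<mu>\<^sup>2 - 1) = \<i> * (r * s * e' / 2)"
    proof -
      have "of_real (\<mu>\<^sup>2 - 1) = - complex_of_real s * s"
        using s2 by (simp add: power2_eq_square flip: of_real_mult of_real_minus)
      also have "\<dots> = - \<i> * s * e' * \<tau>"
        using assms(2) unfolding \<tau>_def by (simp add: algebra_simps)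
      finally have "\<kappa> * of_real (\<mu>\<^sup>2 - 1) = (\<kappa> * \<tau>) * (- \<i> * s * e')" by simp
      then show ?thesis unfolding kl by simp
    qed
    have B: "\<kappa> * of_real (2 * \<mu>) * \<tau> = - of_real (r * \<mu>)"
    proof -
      have "\<kappa> * of_real (2 * \<mu>) * \<tau> = (\<kappa> * \<tau>) * of_real (2 * \<mu>)" by simp
      then show ?thesis unfolding kl by simp
    qed
    have C: "\<kappa> * of_real 1 * \<tau>\<^sup>2 = \<i> * (r * s * e / 2)"
    proof -
      have "\<kappa> * of_real 1 * \<tau>\<^sup>2 = (\<kappa> * \<tau>) * \<tau>" by (simp add: power2_eq_square)
      also have "\<dots> = \<i> * (r * s * e / 2)" unfolding kl by (simp add: \<tau>_def)
      finally show ?thesis .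
    qed
    have "\<kappa> ^ n * \<tau> ^ (n + l) = (- of_real r / 2) ^ n * \<tau> ^ l"
      unfolding kl[symmetric] by (simp add: power_add power_mult_distrib)
    then show ?thesis
      unfolding coeff_quadratic_power_scale[of \<kappa> _ _ \<tau>, of "of_real (\<mu>\<^sup>2 - 1)" "of_real (2 * \<mu>)"
          "of_real 1", unfolded A B C] coeff_quadratic_power_of_real
      by (simp add: \<tau>_def)
  qed
  then show ?thesis unfolding rhs by simp
qed

section \<open>The generating polynomial of the harmonics\<close>

text \<open>This is the dot product of \<open>v\<close> with (i(1 + t^2)/2, (1 - t^2)/2, -t). The
  squares of these components sum to 0, which is why the powers are harmonic in
  \<open>v\<close>.\<close>

definition harmonic_gen :: "real^3 \<Rightarrow> complex poly" where
  "harmonic_gen v = [:\<i> * \<eta>\<^sub>0 v, - of_real (v $ 3), \<i> * \<xi>\<^sub>0 v:]"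

text \<open>The product of norm and sine is the modulus of x + iy. Where an angle is arbitrary, on
  the axis or at the origin, it is multiplied by 0.\<close>

lemma spherical_components:
  defines "\<mu> v \<equiv> cos (polar_angle v)"
  shows "\<bar>\<mu> v\<bar> \<le> 1"
    and "v $ 3 = norm v * \<mu> v"
    and "\<xi>\<^sub>0 v = norm v * sqrt (1 - (\<mu> v)\<^sup>2) * cis (azimuth v) / 2"
    and "\<eta>\<^sub>0 v = norm v * sqrt (1 - (\<mu> v)\<^sup>2) * cis (- azimuth v) / 2"
proof -
  let ?w = "Complex (v $ 1) (v $ 2)"
  show "\<bar>\<mu> v\<bar> \<le> 1" by (simp add: \<mu>_def)
  have mu: "\<mu> v = v $ 3 / norm v"
  proof -
    have "\<bar>v $ 3 / norm v\<bar> \<le> 1"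
      using component_le_norm_cart[of v 3] by (simp add: divide_le_eq_1)
    then show ?thesis by (simp add: \<mu>_def polar_angle_def cos_arccos_abs)
  qed
  then show 3: "v $ 3 = norm v * \<mu> v" by (cases "v = 0") auto
  have "(norm v)\<^sup>2 = (v $ 1)\<^sup>2 + (v $ 2)\<^sup>2 + (v $ 3)\<^sup>2"
    by (simp add: norm_vec_def L2_set_def sum_3)
  then have "(norm v)\<^sup>2 * (1 - (\<mu> v)\<^sup>2) = (v $ 1)\<^sup>2 + (v $ 2)\<^sup>2"
    using arg_cong[OF 3, of "\<lambda>x. x\<^sup>2"] by (simp add: right_diff_distrib power_mult_distrib)
  then have "sqrt ((norm v)\<^sup>2 * (1 - (\<mu> v)\<^sup>2)) = cmod ?w"
    by (simp add: cmod_def)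
  then have w: "norm v * sqrt (1 - (\<mu> v)\<^sup>2) = cmod ?w"
    by (simp add: real_sqrt_mult)
  have "?w = cmod ?w * cis (azimuth v)"
    using rcis_cmod_Arg[of ?w] by (simp add: rcis_def azimuth_def)
  moreover from this have "cnj ?w = cmod ?w * cis (- azimuth v)"
    by (metis cis_cnj complex_cnj_complex_of_real complex_cnj_mult)
  moreover have "\<xi>\<^sub>0 v = ?w / 2" "\<eta>\<^sub>0 v = cnj ?w / 2"
    by (simp_all add: \<xi>\<^sub>0_def \<eta>\<^sub>0_def complex_eq_iff)
  ultimately show "\<xi>\<^sub>0 v = norm v * sqrt (1 - (\<mu> v)\<^sup>2) * cis (azimuth v) / 2"
    "\<eta>\<^sub>0 v = norm v * sqrt (1 - (\<mu> v)\<^sup>2) * cis (- azimuth v) / 2"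
    unfolding of_real_mult[symmetric] w by simp_all
qed

text \<open>The lower bound on \<open>m\<close> keeps \<open>nat\<close> from truncating; for
  \<open>m > n\<close> both sides are 0, by the degree of the power.\<close>

lemma harmonic_R_eq_coeff:
  assumes "- int n \<le> m"
  shows "harmonic_R n m v = coeff (harmonic_gen v ^ n) (nat (int n + m)) / fact n"
proof -
  note sph = spherical_components[of v]
  define \<mu> where "\<mu> = cos (polar_angle v)"
  define s where "s = sqrt (1 - \<mu>\<^sup>2)"
  have gen: "harmonic_gen v = [:\<i> * (norm v * s * cis (- azimuth v) / 2), - of_real (norm v * \<mu>),
      \<i> * (norm v * s * cis (azimuth v) / 2):]"
    unfolding harmonic_gen_def sph(2,3,4) \<mu>_def s_def ..
  have \<mu>: "\<bar>\<mu>\<bar> \<le> 1" unfolding \<mu>_def by (rule sph)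
  consider "m > int n" | l where "m = int l" "l \<le> n" | l where "m = - int l" "l \<le> n"
    using assms by (cases m) fastforce+
  then show ?thesis
  proof cases
    case 1
    then have "2 * n < nat (int n + m)" by simp
    with 1 show ?thesis
      by (simp add: harmonic_R_def harmonic_gen_def coeff_quadratic_power_eq_0)
  next
    case 2
    have "cis (azimuth v) ^ l = exp (\<i> * of_int m * of_real (azimuth v))"
      using 2 by (simp add: cis_conv_exp mult_ac flip: exp_of_nat_mult)
    moreover have "nat (int n + m) = n + l" using 2 by simp
    ultimately show ?thesis
      using 2 coeff_eq_assoc_legendre[OF \<mu>, of "cis (azimuth v)" "cis (- azimuth v)" "norm v" n l]
      unfolding gen s_def harmonic_R_def \<mu>_def[symmetric] by (simp add: cis_mult)
  next
    case 3
    have "cis (- azimuth v) ^ l = exp (\<i> * of_int m * of_real (azimuth v))"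
      using 3 by (simp add: cis_conv_exp mult_ac flip: exp_of_nat_mult)
    \<comment> \<open>Reflection moves the index from n - l to n + l and exchanges the outer
      coefficients, so \<open>cis (- azimuth v)\<close> takes the role of \<open>e\<close>.\<close>
    moreover have "nat (int n + m) + (n + l) = 2 * n" using 3 by simp
    then have "coeff (harmonic_gen v ^ n) (nat (int n + m))
      = coeff ([:\<i> * (norm v * s * cis (azimuth v) / 2), - of_real (norm v * \<mu>),
        \<i> * (norm v * s * cis (- azimuth v) / 2):] ^ n) (n + l)"
      unfolding gen by (rule coeff_quadratic_power_reflect)
    ultimately show ?thesis
      using 3 coeff_eq_assoc_legendre[OF \<mu>, of "cis (- azimuth v)" "cis (azimuth v)" "norm v" n l]
      unfolding s_def harmonic_R_def \<mu>_def[symmetric] by (simp add: cis_mult)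
  qed
qed

text \<open>The three coefficients of the quadratic shift the index n + m by 0, 1, 2, which at
  degree n - 1 means order m + 1, m, m - 1. A shift below index 0 meets an order outside the range,
  where \<open>harmonic_R\<close> is 0.\<close>

lemma coeff_harmonic_gen_mult:
  assumes "n \<ge> 1" "- int n \<le> m" "m \<le> int n"
  shows "coeff (harmonic_gen w * harmonic_gen v ^ (n - 1)) (nat (int n + m)) / fact (n - 1)
    = \<i> * \<xi>\<^sub>0 w * harmonic_R (n - 1) (m - 1) v + \<i> * \<eta>\<^sub>0 w * harmonic_R (n - 1) (m + 1) v
      - of_real (w $ 3) * harmonic_R (n - 1) m v"
proof -
  define k where "k = nat (int n + m)"
  have k: "int k = int n + m" using assms by (simp add: k_def)
  let ?c = "\<lambda>j. coeff (harmonic_gen v ^ (n - 1)) j / fact (n - 1)"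
  have up: "harmonic_R (n - 1) (m + 1) v = ?c k"
  proof -
    have "nat (int (n - 1) + (m + 1)) = k" using assms(1) k by simp
    then show ?thesis using harmonic_R_eq_coeff[of "n - 1" "m + 1" v] assms by simp
  qed
  have mid: "harmonic_R (n - 1) m v = (if 1 \<le> k then ?c (k - 1) else 0)"
  proof (cases "1 \<le> k")
    case True
    then have "nat (int (n - 1) + m) = k - 1" "- int (n - 1) \<le> m" using assms(1) k by auto
    then show ?thesis using True harmonic_R_eq_coeff[of "n - 1" m v] by simp
  next
    case False
    then show ?thesis using k assms by (simp add: harmonic_R_def)
  qed
  have down: "harmonic_R (n - 1) (m - 1) v = (if 2 \<le> k then ?c (k - 2) else 0)"
  proof (cases "2 \<le> k")
    case True
    then have "nat (int (n - 1) + (m - 1)) = k - 2" "- int (n - 1) \<le> m - 1" using assms(1) k by auto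
    then show ?thesis using True harmonic_R_eq_coeff[of "n - 1" "m - 1" v] by simp
  next
    case False
    then show ?thesis using k assms by (simp add: harmonic_R_def)
  qed
  show ?thesis
    unfolding up mid down k_def[symmetric] harmonic_gen_def[of w] coeff_quadratic_mult
    by (simp add: field_simps)
qed

section \<open>Differentiation along the segment\<close>

text \<open>Each coefficient of a product is a finite Cauchy sum, so the product rule for scalars
  applies termwise.\<close>

lemma has_vector_derivative_coeff_mult:
  fixes P Q :: "real \<Rightarrow> 'a::{real_normed_field} poly"
  assumes "\<And>k. ((\<lambda>u. coeff (P u) k) has_vector_derivative coeff P' k) (at x within S)"
    and "\<And>k. ((\<lambda>u. coeff (Q u) k) has_vector_derivative coeff Q' k) (at x within S)"
  shows "((\<lambda>u. coeff (P u * Q u) k) has_vector_derivative coeff (P' * Q x + P x * Q') k) (at x within S)"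
proof -
  have "((\<lambda>u. \<Sum>i\<le>k. coeff (P u) i * coeff (Q u) (k - i)) has_vector_derivative
      (\<Sum>i\<le>k. coeff (P x) i * coeff Q' (k - i) + coeff P' i * coeff (Q x) (k - i))) (at x within S)"
    by (intro has_vector_derivative_sum has_vector_derivative_mult assms)
  then show ?thesis by (simp add: coeff_mult sum.distrib add.commute)
qed

lemma has_vector_derivative_coeff_power:
  fixes P :: "real \<Rightarrow> 'a::{real_normed_field} poly"
  assumes "\<And>k. ((\<lambda>u. coeff (P u) k) has_vector_derivative coeff P' k) (at x within S)"
  shows "((\<lambda>u. coeff (P u ^ n) k) has_vector_derivative of_nat n * coeff (P' * P x ^ (n - 1)) k) (at x within S)"
proof (induction n arbitrary: k)
  case 0
  then show ?case by simp
next
  case (Suc n)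
  let ?D = "of_nat n * (P' * P x ^ (n - 1))"
  have D: "coeff ?D j = of_nat n * coeff (P' * P x ^ (n - 1)) j" for j
    by (simp add: of_nat_poly)
  have "((\<lambda>u. coeff (P u * P u ^ n) k) has_vector_derivative
      coeff (P' * P x ^ n + P x * ?D) k) (at x within S)"
    by (rule has_vector_derivative_coeff_mult) (use assms Suc D in simp_all)
  \<comment> \<open>For \<open>n = 0\<close> the factor \<open>of_nat n\<close> kills the term with
    the truncated exponent \<open>n - 1\<close>.\<close>
  also have "P' * P x ^ n + P x * ?D = of_nat (Suc n) * (P' * P x ^ n)"
    by (cases n) (simp_all add: algebra_simps)
  finally show ?case by (simp add: of_nat_poly)
qed

lemma harmonic_gen_segment:
  "harmonic_gen (segment_point Ru R0 u) = smult (of_real u) (harmonic_gen Ru) + harmonic_gen R0"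
  by (simp add: harmonic_gen_def segment_point_def \<xi>\<^sub>0_def \<eta>\<^sub>0_def field_simps)

lemma coeff_harmonic_gen_segment_has_vector_derivative:
  "((\<lambda>u. coeff (harmonic_gen (segment_point Ru R0 u)) k)
    has_vector_derivative coeff (harmonic_gen Ru) k) (at u within S)"
  unfolding harmonic_gen_segment coeff_add coeff_smult
  by (auto intro!: derivative_eq_intros)

text \<open>Power rule for g^n / n!, where g has the constant derivative
  \<open>harmonic_gen Ru\<close> along the segment.\<close>

lemma seg_r_has_vector_derivative:
  assumes "n \<ge> 1" "- int n \<le> m"
  shows "(seg_r Ru R0 n m has_vector_derivative
    coeff (harmonic_gen Ru * harmonic_gen (segment_point Ru R0 u) ^ (n - 1)) (nat (int n + m))
      / fact (n - 1)) (at u within S)"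
proof -
  have f: "of_nat n * X / fact n = X / fact (n - 1)" for X :: complex
    using assms(1) by (cases n) (simp_all del: of_nat_Suc)
  have r: "seg_r Ru R0 n m = (\<lambda>u. coeff (harmonic_gen (segment_point Ru R0 u) ^ n) (nat (int n + m)) / fact n)"
    using assms(2) by (simp add: seg_r_def harmonic_R_eq_coeff fun_eq_iff)
  have "((\<lambda>u. coeff (harmonic_gen (segment_point Ru R0 u) ^ n) (nat (int n + m)) / fact n)
      has_vector_derivative
      of_nat n * coeff (harmonic_gen Ru * harmonic_gen (segment_point Ru R0 u) ^ (n - 1)) (nat (int n + m))
        / fact n) (at u within S)"
    by (intro has_vector_derivative_divide has_vector_derivative_coeff_power
        coeff_harmonic_gen_segment_has_vector_derivative)
  then show ?thesis
    unfolding r f .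
qed

lemma seg_r_integrable: "seg_r Ru R0 n m integrable_on {a..b}"
proof (cases "n \<ge> 1 \<and> - int n \<le> m")
  case True
  then have "continuous_on {a..b} (seg_r Ru R0 n m)"
    by (intro continuous_on_vector_derivative) (rule seg_r_has_vector_derivative, auto)
  then show ?thesis by (rule integrable_continuous_interval)
next
  case False
  \<comment> \<open>Here n = 0 or m < -n, so the function is constantly 0 or 1 and any point, such
    as 0, gives its value.\<close>
  then have "seg_r Ru R0 n m = (\<lambda>_. harmonic_R n m 0)"
    by (cases n) (auto simp: seg_r_def harmonic_R_def assoc_legendre_0_0 fun_eq_iff)
  then show ?thesis by (simp add: integrable_const_ivl)
qed

theorem lemma1:
  fixes Ru R0 :: "real^3" and n :: nat and m :: int
  assumes "n \<ge> 1" and "- int n \<le> m" and "m \<le> int n"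
  shows "seg_p Ru R0 n m =
    1 / (of_nat n + 1) *
      (\<i> * \<xi>\<^sub>0 R0 * seg_p Ru R0 (n - 1) (m - 1)
       + \<i> * \<eta>\<^sub>0 R0 * seg_p Ru R0 (n - 1) (m + 1)
       - of_real (R0 $ 3) * seg_p Ru R0 (n - 1) m
       + seg_q Ru R0 n m)"
proof -
  let ?r = "seg_r Ru R0"
  let ?k = "nat (int n + m)"
  let ?G = "\<lambda>u. harmonic_gen (segment_point Ru R0 u) ^ (n - 1)"
  define d where "d u = coeff (harmonic_gen Ru * ?G u) ?k / fact (n - 1)" for u
  define t where "t u = \<i> * \<xi>\<^sub>0 R0 * ?r (n - 1) (m - 1) u + \<i> * \<eta>\<^sub>0 R0 * ?r (n - 1) (m + 1) u
    - of_real (R0 $ 3) * ?r (n - 1) m u" for u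
  have t: "t u = coeff (harmonic_gen R0 * ?G u) ?k / fact (n - 1)" for u
    unfolding t_def seg_r_def coeff_harmonic_gen_mult[OF assms] ..
  have euler: "of_nat n * ?r n m u = of_real u * d u + t u" for u
  proof -
    have f: "fact n = of_nat n * (fact (n - 1) :: complex)" using assms(1) by (simp add: fact_reduce)
    have "harmonic_gen (segment_point Ru R0 u) ^ n = harmonic_gen (segment_point Ru R0 u) * ?G u"
      using assms(1) by (simp add: power_eq_if)
    then have "of_nat n * ?r n m u
      = coeff (harmonic_gen (segment_point Ru R0 u) * ?G u) ?k / fact (n - 1)"
      using assms by (simp add: seg_r_def harmonic_R_eq_coeff f)
    also have "\<dots> = of_real u * d u + t u"
      \<comment> \<open>Only the split-off factor is expanded; the copies inside \<open>?G u\<close>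
        stay intact.\<close>
      by (subst (1) harmonic_gen_segment) (simp add: t d_def distrib_right add_divide_distrib)
    finally show ?thesis .
  qed
  have int: "(?r j l has_integral seg_p Ru R0 j l) {0..1}" for j l
    unfolding seg_p_def by (intro integrable_integral seg_r_integrable)
  have "((\<lambda>u. of_real u * ?r n m u) has_vector_derivative of_real u * d u + ?r n m u) (at u within {0..1})" for u
    unfolding d_def using assms
    by (auto intro!: derivative_eq_intros seg_r_has_vector_derivative)
  \<comment> \<open>The weight u removes the boundary term at 0, so only r(1), that is q,
    remains.\<close>
  then have "((\<lambda>u. of_real u * d u + ?r n m u) has_integral of_real 1 * ?r n m 1 - of_real 0 * ?r n m 0) {0..1}"
    by (intro fundamental_theorem_of_calculus) auto
  then have ftc: "((\<lambda>u. (of_nat n + 1) * ?r n m u - t u) has_integral ?r n m 1) {0..1}"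
    using euler by (simp add: algebra_simps)
  have t_int: "(t has_integral (\<i> * \<xi>\<^sub>0 R0 * seg_p Ru R0 (n - 1) (m - 1)
      + \<i> * \<eta>\<^sub>0 R0 * seg_p Ru R0 (n - 1) (m + 1)
      - of_real (R0 $ 3) * seg_p Ru R0 (n - 1) m)) {0..1}" (is "(t has_integral ?T) _")
    unfolding t_def[abs_def]
    by (intro has_integral_add has_integral_diff has_integral_mult_right int)
  have "((\<lambda>u. (of_nat n + 1) * ?r n m u - t u) has_integral
      (of_nat n + 1) * seg_p Ru R0 n m - ?T) {0..1}"
    by (intro has_integral_diff has_integral_mult_right int t_int)
  from has_integral_unique[OF this ftc] have "(of_nat n + 1) * seg_p Ru R0 n m - ?T = seg_q Ru R0 n m"
    unfolding seg_q_def .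
  then have "(of_nat n + 1) * seg_p Ru R0 n m = ?T + seg_q Ru R0 n m"
    by (simp add: algebra_simps)
  moreover have "(of_nat n + 1 :: complex) \<noteq> 0"
    by (metis of_nat_Suc of_nat_neq_0 add.commute)
  ultimately show ?thesis
    by (simp add: nonzero_eq_divide_eq mult.commute)
qed

end
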